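(* Let $R$ be a complete rank ring. Then the assignment $$E\longmapsto\{eR\mid e\in E\}$$ is a well-defined surjection from the set of all nests in $R$ onto the set of all flags over $R$.
   Context: A unital ring $R$ is (von Neumann) regular if for every $a\in R$ there is $b\in R$ with $aba=a$. A rank function on a regular ring $R$ is a map $\rho\colon R\to[0,1]$ with $\rho(1)=1$, $\rho(ab)\le\min\{\rho(a),\rho(b)\}$ for all $a,b\in R$, $\rho(e+f)=\rho(e)+\rho(f)$ for all idempotents $e,f\in R$ with $ef=fe=0$, and $\rho(a)>0$ for all $a\in R\setminus\{0\}$. Then $d_\rho(a,b):=\rho(a-b)$ is a metric on $R$; $\rho$ is complete if $(R,d_\rho)$ is a complete metric space. A complete rank ring is a regular ring admitting a complete rank function. $\mathrm{E}(R)$ is the set of idempotents of $R$, partially ordered by $e\le f:\Leftrightarrow ef=fe=e$. A nest in $R$ is a chain in $(\mathrm{E}(R),\le)$. $\mathrm{L}(R):=\{aR\mid a\in R\}$, ordered by inclusion; a flag over $R$ is a chain in $(\mathrm{L}(R),\subseteq)$. *)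

theory Defs
  imports "HOL-Analysis.Analysis"
begin

definition regular_ring :: "'a::ring_1 itself \<Rightarrow> bool" where
  "regular_ring _ \<longleftrightarrow> (\<forall>a::'a. \<exists>b. a * b * a = a)"

definition idempotents :: "'a::ring_1 set" where
  "idempotents = {e. e * e = e}"

definition rank_function :: "('a::ring_1 \<Rightarrow> real) \<Rightarrow> bool" where
  "rank_function \<rho> \<longleftrightarrow>
     range \<rho> \<subseteq> {0..1} \<and>
     \<rho> 1 = 1 \<and>
     (\<forall>a b. \<rho> (a * b) \<le> min (\<rho> a) (\<rho> b)) \<and>
     (\<forall>e\<in>idempotents. \<forall>f\<in>idempotents. e * f = 0 \<and> f * e = 0 \<longrightarrow> \<rho> (e + f) = \<rho> e + \<rho> f) \<and>
     (\<forall>a. a \<noteq> 0 \<longrightarrow> 0 < \<rho> a)"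

definition rank_dist :: "('a::ring_1 \<Rightarrow> real) \<Rightarrow> 'a \<Rightarrow> 'a \<Rightarrow> real" where
  "rank_dist \<rho> a b = \<rho> (a - b)"

(* The library constant Metric_space.mcomplete is only meaningful for metrics;
   Metric_space_rank_dist below shows that rank_dist is one. *)
definition complete_rank_function :: "('a::ring_1 \<Rightarrow> real) \<Rightarrow> bool" where
  "complete_rank_function \<rho> \<longleftrightarrow>
     rank_function \<rho> \<and> Metric_space.mcomplete UNIV (rank_dist \<rho>)"

definition complete_rank_ring :: "'a::ring_1 itself \<Rightarrow> bool" where
  "complete_rank_ring R \<longleftrightarrow>
     regular_ring R \<and> (\<exists>\<rho>::'a \<Rightarrow> real. complete_rank_function \<rho>)"

definition idem_le :: "'a::ring_1 \<Rightarrow> 'a \<Rightarrow> bool" where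
  "idem_le e f \<longleftrightarrow> e * f = e \<and> f * e = e"

definition principal_right_ideal :: "'a::ring_1 \<Rightarrow> 'a set" where
  "principal_right_ideal a = {a * x | x. True}"

definition principal_right_ideals :: "'a::ring_1 set set" where
  "principal_right_ideals = {principal_right_ideal a | a. True}"

(* Complete_Partial_Order.chain is the plain notion of a chain: any two elements are
   comparable. In particular the empty set is both a nest and a flag. *)
definition nests :: "'a::ring_1 set set" where
  "nests = {E. E \<subseteq> idempotents \<and> Complete_Partial_Order.chain idem_le E}"

definition flags :: "'a::ring_1 set set set" where
  "flags = {F. F \<subseteq> principal_right_ideals \<and> Complete_Partial_Order.chain (\<subseteq>) F}"

lemma rank_function_zero:
  fixes \<rho> :: "'a::ring_1 \<Rightarrow> real"
  assumes "rank_function \<rho>"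
  shows "\<rho> 0 = 0"
proof -
  have "(0::'a) \<in> idempotents" by (simp add: idempotents_def)
  then have "\<rho> (0 + 0) = \<rho> 0 + \<rho> 0"
    using assms unfolding rank_function_def by (meson mult_zero_left)
  then show ?thesis by simp
qed

lemma rank_function_add_le:
  fixes \<rho> :: "'a::ring_1 \<Rightarrow> real"
  assumes reg: "regular_ring TYPE('a)" and rk: "rank_function \<rho>"
  shows "\<rho> (a + b) \<le> \<rho> a + \<rho> b"
proof -
  have mono: "\<rho> (x * y) \<le> \<rho> x" "\<rho> (x * y) \<le> \<rho> y" for x y
    using rk by (auto simp: rank_function_def)
  obtain a' where a': "a * a' * a = a" using reg by (auto simp: regular_ring_def)
  define e where "e = a * a'"
  have ea: "e * a = a" using a' by (simp add: e_def)
  have ee: "e * e = e" using arg_cong[OF ea, of "\<lambda>x. x * a'"] by (simp add: e_def mult.assoc)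
  define c where "c = b - e * b"
  have ec: "e * c = 0" by (simp add: c_def right_diff_distrib mult.assoc[symmetric] ee)
  obtain c' where c': "c * c' * c = c" using reg by (auto simp: regular_ring_def)
  define f where "f = c * c'"
  have fc: "f * c = c" using c' by (simp add: f_def)
  have ff: "f * f = f" using arg_cong[OF fc, of "\<lambda>x. x * c'"] by (simp add: f_def mult.assoc)
  have ef: "e * f = 0" by (simp add: f_def mult.assoc[symmetric] ec)
  define g where "g = f * (1 - e)"
  have ge: "g * e = 0" by (simp add: g_def mult.assoc left_diff_distrib ee)
  have eg: "e * g = 0" by (simp add: g_def mult.assoc[symmetric] ef)
  have gf: "g * f = f" by (simp add: g_def mult.assoc left_diff_distrib ff ef)
  have gg: "g * g = g"
    using arg_cong[OF gf, of "\<lambda>x. x * (1 - e)"] by (simp add: g_def mult.assoc)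
  have ga: "g * a = 0" using arg_cong[OF ge, of "\<lambda>x. x * a"] by (simp add: mult.assoc ea)
  have gb: "g * b = c"
    using fc by (simp add: g_def c_def mult.assoc left_diff_distrib)
  have "(e + g) * (a + b) = a + b"
    by (simp add: distrib_left distrib_right ea ga gb c_def)
  then have "\<rho> (a + b) \<le> \<rho> (e + g)" using mono(1)[of "e + g" "a + b"] by simp
  moreover have "\<rho> (e + g) = \<rho> e + \<rho> g"
    using rk ee gg eg ge by (simp add: rank_function_def idempotents_def)
  moreover have "\<rho> e \<le> \<rho> a" unfolding e_def by (rule mono)
  moreover have "\<rho> g \<le> \<rho> f" unfolding g_def by (rule mono)
  moreover have "\<rho> f \<le> \<rho> c" unfolding f_def by (rule mono)
  moreover have "\<rho> c \<le> \<rho> b" unfolding gb[symmetric] by (rule mono)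
  ultimately show ?thesis by linarith
qed

lemma Metric_space_rank_dist:
  fixes \<rho> :: "'a::ring_1 \<Rightarrow> real"
  assumes reg: "regular_ring TYPE('a)" and rk: "rank_function \<rho>"
  shows "Metric_space UNIV (rank_dist \<rho>)"
proof (rule Metric_space.intro)
  fix x y z :: 'a
  have neg: "\<rho> (- u) \<le> \<rho> u" for u
  proof -
    have "\<rho> (a * b) \<le> \<rho> b" for a b using rk by (simp add: rank_function_def)
    from this[of "- 1" u] show ?thesis by simp
  qed
  show "0 \<le> rank_dist \<rho> x y"
    using rk by (simp add: rank_function_def rank_dist_def image_subset_iff)
  show "rank_dist \<rho> x y = rank_dist \<rho> y x"
    using neg[of "x - y"] neg[of "y - x"] by (simp add: rank_dist_def)
  show "rank_dist \<rho> x y = 0 \<longleftrightarrow> x = y"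
  proof -
    have "0 < \<rho> (x - y)" if "x \<noteq> y"
      using rk that unfolding rank_function_def by simp
    then show ?thesis using rank_function_zero[OF rk] by (fastforce simp: rank_dist_def)
  qed
  show "rank_dist \<rho> x z \<le> rank_dist \<rho> x y + rank_dist \<rho> y z"
    using rank_function_add_le[OF reg rk, of "x - y" "y - z"] by (simp add: rank_dist_def)
qed

end

theory Submission
  imports Defs
begin

text \<open>
  The lift of a flag is obtained by Zorn's lemma. Let \<open>M\<close> be a maximal nest whose image lies in
  the flag \<open>F\<close>, and let \<open>gR\<close> be a member of \<open>F\<close> with \<open>g\<close> idempotent. Since \<open>\<rho> (f - e) = \<rho> f - \<rho> e\<close>
  for \<open>e \<le> f\<close>, a sequence in a nest whose ranks approach their supremum is Cauchy, so by completeness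
  the elements of \<open>M\<close> below \<open>gR\<close> have a supremum \<open>l\<close> in their closure and, dually, those above have an
  infimum \<open>u\<close>. Then \<open>l \<le> u\<close> and \<open>lR \<subseteq> gR \<subseteq> uR\<close>, and \<open>(l + g - lg)u\<close> is an idempotent between \<open>l\<close> and
  \<open>u\<close> that generates \<open>gR\<close>. By maximality it belongs to \<open>M\<close>.
\<close>

section \<open>Idempotents, nests and principal right ideals\<close>

lemma idem_le_refl: "e \<in> idempotents \<Longrightarrow> idem_le e e"
  by (simp add: idempotents_def idem_le_def)

lemma idem_le_trans: "idem_le e f \<Longrightarrow> idem_le f g \<Longrightarrow> idem_le e g"
  unfolding idem_le_def by (metis mult.assoc)

lemma idem_le_compl: "idem_le e f \<Longrightarrow> idem_le (1 - f) (1 - e)"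
  by (simp add: idem_le_def algebra_simps)

lemma idempotents_compl: "e \<in> idempotents \<Longrightarrow> 1 - e \<in> idempotents"
  by (simp add: idempotents_def algebra_simps)

text \<open>Complementation reverses the order of idempotents, so infima can be obtained as suprema
  of complements.\<close>

lemma nests_compl:
  assumes "E \<in> nests"
  shows "(\<lambda>e. 1 - e) ` E \<in> nests"
  using assms idem_le_compl idempotents_compl
  unfolding nests_def chain_def by fastforce

lemma nests_subset: "E \<in> nests \<Longrightarrow> D \<subseteq> E \<Longrightarrow> D \<in> nests"
  unfolding nests_def chain_def by blast

text \<open>An idempotent acts as a left identity on the right ideal it generates. Inclusions
  thereby become equations, which survive limits.\<close>

lemma principal_right_ideal_subset_iff:
  assumes "e \<in> idempotents"
  shows "principal_right_ideal a \<subseteq> principal_right_ideal e \<longleftrightarrow> e * a = a"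
proof
  assume "principal_right_ideal a \<subseteq> principal_right_ideal e"
  moreover have "a \<in> principal_right_ideal a"
    unfolding principal_right_ideal_def by (metis (mono_tags) mem_Collect_eq mult_1_right)
  ultimately obtain x where "a = e * x"
    unfolding principal_right_ideal_def by auto
  then show "e * a = a"
    using assms by (simp add: idempotents_def mult.assoc[symmetric])
next
  assume "e * a = a"
  then show "principal_right_ideal a \<subseteq> principal_right_ideal e"
    unfolding principal_right_ideal_def by (auto simp: mult.assoc) (metis mult.assoc)
qed

lemma principal_right_ideal_mono:
  assumes "f \<in> idempotents" "idem_le e f"
  shows "principal_right_ideal e \<subseteq> principal_right_ideal f"
  using assms by (simp add: principal_right_ideal_subset_iff idem_le_def)

text \<open>Regularity provides \<open>b\<close> with \<open>a * b * a = a\<close>; then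
  \<open>a * b\<close> is idempotent and generates the same right ideal as \<open>a\<close>.\<close>

lemma idempotent_generator:
  assumes reg: "regular_ring TYPE('a::ring_1)"
    and "I \<in> (principal_right_ideals :: 'a set set)"
  obtains e where "e \<in> idempotents" "principal_right_ideal e = I"
proof -
  obtain a where a: "I = principal_right_ideal a"
    using assms(2) by (auto simp: principal_right_ideals_def)
  obtain b where b: "a * b * a = a"
    using reg by (auto simp: regular_ring_def)
  have e: "a * b \<in> idempotents"
    by (simp add: idempotents_def b mult.assoc[symmetric])
  have "principal_right_ideal (a * b) \<subseteq> principal_right_ideal a"
    by (auto simp: principal_right_ideal_def mult.assoc)
  with principal_right_ideal_subset_iff[OF e] b have "principal_right_ideal (a * b) = I"
    by (metis a subset_antisym)
  with e show thesis by (rule that)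
qed

lemma image_nest_in_flags:
  assumes "E \<in> nests"
  shows "principal_right_ideal ` E \<in> flags"
  unfolding flags_def
proof (intro CollectI conjI)
  show "principal_right_ideal ` E \<subseteq> principal_right_ideals"
    by (auto simp: principal_right_ideals_def)
  show "Complete_Partial_Order.chain (\<subseteq>) (principal_right_ideal ` E)"
    using assms principal_right_ideal_mono unfolding nests_def chain_def by blast
qed

lemma idempotent_interpolation:
  fixes e f g :: "'a::ring_1"
  assumes e: "e \<in> idempotents" and f: "f \<in> idempotents" and g: "g \<in> idempotents"
    and ef: "idem_le e f" and ge: "g * e = e" and fg: "f * g = g"
  obtains h where "h \<in> idempotents" "idem_le e h" "idem_le h f"
    "principal_right_ideal h = principal_right_ideal g"
proof -
  have ee: "e * e = e" "f * f = f" "g * g = g"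
    using e f g by (simp_all add: idempotents_def)
  have ef': "e * f = e" "f * e = e" using ef by (simp_all add: idem_le_def)
  \<comment> \<open>This is \<open>1 - (1 - e) * (1 - g)\<close>. It is an idempotent above
    \<open>e\<close> generating the same ideal as \<open>g\<close>, but only
    \<open>f * k = k\<close> is available, not \<open>k * f = k\<close>.\<close>
  define k where "k = e + g - e * g"
  have gk: "g * k = k"
    by (simp add: k_def algebra_simps ee ge flip: mult.assoc)
  have kg: "k * g = g"
    by (simp add: k_def algebra_simps ee)
  have ek: "e * k = e"
    by (simp add: k_def algebra_simps ee flip: mult.assoc)
  have ke: "k * e = e"
    by (simp add: k_def algebra_simps ee ge)
  have fk: "f * k = k"
    by (simp add: k_def algebra_simps ef' fg flip: mult.assoc)
  have kk: "k * k = k"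
    by (metis gk kg mult.assoc)
  \<comment> \<open>Multiplying by \<open>f\<close> on the right forces \<open>h * f = h\<close>.
    Idempotence and the generated ideal survive because \<open>f * k = k\<close>, and
    \<open>e\<close> stays below because \<open>e * f = e\<close>.\<close>
  define h where "h = k * f"
  have hk: "h * k = k" by (simp add: h_def mult.assoc fk kk)
  have hh: "h * h = h" by (metis h_def hk mult.assoc)
  then have h: "h \<in> idempotents" by (simp add: idempotents_def)
  have "h * g = g" by (metis hk kg mult.assoc)
  moreover have "g * h = h" by (metis h_def gk mult.assoc)
  ultimately have "principal_right_ideal h = principal_right_ideal g"
    using principal_right_ideal_subset_iff[OF h] principal_right_ideal_subset_iff[OF g] by blast
  moreover have "idem_le e h"
    unfolding idem_le_def h_def by (metis ek ke ef' mult.assoc)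
  moreover have "idem_le h f"
    unfolding idem_le_def h_def by (metis ee(2) fk mult.assoc)
  ultimately show thesis using h that by blast
qed

section \<open>The rank metric and limits of equations\<close>

locale complete_rank =
  fixes \<rho> :: "'a::ring_1 \<Rightarrow> real"
  assumes reg: "regular_ring TYPE('a)" and complete: "complete_rank_function \<rho>"
begin

lemma rank: "rank_function \<rho>"
  using complete by (simp add: complete_rank_function_def)

sublocale Metric_space UNIV "rank_dist \<rho>"
  by (rule Metric_space_rank_dist[OF reg rank])

lemma rank_bounds: "0 \<le> \<rho> a" "\<rho> a \<le> 1"
  using rank by (auto simp: rank_function_def image_subset_iff)

lemma rank_mult_le: "\<rho> (a * b) \<le> \<rho> a" "\<rho> (a * b) \<le> \<rho> b"
  using rank by (simp_all add: rank_function_def)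

lemma rank_add_le: "\<rho> (a + b) \<le> \<rho> a + \<rho> b"
  by (rule rank_function_add_le[OF reg rank])

lemma rank_minus: "\<rho> (- a) = \<rho> a"
  using rank_mult_le(2)[of "- 1" a] rank_mult_le(2)[of "- 1" "- a"] by simp

lemma rank_diff_le: "\<rho> (a - b) \<le> \<rho> a + \<rho> b"
  using rank_add_le[of a "- b"] by (simp add: rank_minus)

lemma rank_eq_0:
  assumes "\<And>\<epsilon>. 0 < \<epsilon> \<Longrightarrow> \<rho> a \<le> \<epsilon>"
  shows "a = 0"
proof (rule ccontr)
  assume "a \<noteq> 0"
  then have "0 < \<rho> a" using rank by (simp add: rank_function_def)
  then show False using assms[of "\<rho> a / 2"] by simp
qed

text \<open>Here \<open>f - e\<close> is an idempotent orthogonal to \<open>e\<close>, so additivity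
  of the rank applies.\<close>

lemma rank_diff_idem_le:
  assumes e: "e \<in> idempotents" and f: "f \<in> idempotents" and ef: "idem_le e f"
  shows "\<rho> (f - e) = \<rho> f - \<rho> e"
proof -
  have "f - e \<in> idempotents" "e * (f - e) = 0" "(f - e) * e = 0"
    using e f ef by (simp_all add: idempotents_def idem_le_def algebra_simps)
  then have "\<rho> (e + (f - e)) = \<rho> e + \<rho> (f - e)"
    using rank e unfolding rank_function_def by blast
  then show ?thesis by simp
qed

text \<open>Restricted to a nest, the rank is an isometry into the reals, so Cauchy sequences can be
  recognised by their ranks.\<close>

lemma rank_diff_nest:
  assumes "E \<in> nests" "e \<in> E" "f \<in> E"
  shows "\<rho> (e - f) = \<bar>\<rho> e - \<rho> f\<bar>"
proof -
  have idem: "e \<in> idempotents" "f \<in> idempotents" and cmp: "idem_le e f \<or> idem_le f e"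
    using assms by (auto simp: nests_def chain_def)
  from cmp show ?thesis
  proof
    assume "idem_le e f"
    then show ?thesis
      using rank_diff_idem_le[of e f] idem rank_minus[of "f - e"] rank_bounds(1)[of "f - e"] by simp
  next
    assume "idem_le f e"
    then show ?thesis
      using rank_diff_idem_le[of f e] idem rank_bounds(1)[of "e - f"] by simp
  qed
qed

text \<open>This is membership in the closure of \<open>E\<close> for
  \<open>rank_dist \<rho>\<close>.\<close>

definition adherent :: "'a \<Rightarrow> 'a set \<Rightarrow> bool" where
  "adherent l E \<longleftrightarrow> (\<forall>\<epsilon>>0. \<exists>x\<in>E. \<rho> (l - x) < \<epsilon>)"

text \<open>Multiplication by fixed elements does not increase rank distance, so both sides are
  continuous in \<open>x\<close>. Coefficients 1 and 0 give the one-sided and the homogeneous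
  equations.\<close>

lemma adherent_equation:
  assumes "adherent l E" and eq: "\<And>x. x \<in> E \<Longrightarrow> a * x * b = c * x * d"
  shows "a * l * b = c * l * d"
proof -
  have "a * l * b - c * l * d = 0"
  proof (rule rank_eq_0)
    fix \<epsilon> :: real
    assume "0 < \<epsilon>"
    then obtain x where x: "x \<in> E" "\<rho> (l - x) < \<epsilon> / 2"
      using assms(1) unfolding adherent_def by (meson half_gt_zero)
    have "a * l * b - c * l * d = a * (l - x) * b - c * (l - x) * d"
      using eq[OF x(1)] by (simp add: algebra_simps)
    also have "\<rho> \<dots> \<le> \<rho> (a * (l - x) * b) + \<rho> (c * (l - x) * d)"
      by (rule rank_diff_le)
    also have "\<dots> \<le> \<rho> (l - x) + \<rho> (l - x)"
      by (meson add_mono order_trans rank_mult_le)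
    finally show "\<rho> (a * l * b - c * l * d) \<le> \<epsilon>" using x(2) by simp
  qed
  then show ?thesis by simp
qed

section \<open>Suprema of nests and idempotents filling a cut\<close>

lemma nest_supremum:
  assumes nest: "E \<in> nests" and "E \<noteq> {}"
  obtains l where "l \<in> idempotents" "adherent l E" "\<And>e. e \<in> E \<Longrightarrow> idem_le e l"
proof -
  define s where "s = Sup (\<rho> ` E)"
  have bdd: "bdd_above (\<rho> ` E)" using rank_bounds(2) by (auto intro!: bdd_aboveI)
  have le_s: "\<rho> e \<le> s" if "e \<in> E" for e
    unfolding s_def using bdd that by (simp add: cSUP_upper)
  \<comment> \<open>The ranks of the chosen sequence tend to their supremum \<open>s\<close>; within
    a nest this makes the sequence itself Cauchy.\<close>
  have "\<exists>e\<in>E. s - inverse (real (Suc n)) < \<rho> e" for n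
    using less_cSUP_iff[OF assms(2) bdd, of "s - inverse (real (Suc n))"] by (simp add: s_def)
  then obtain x where x: "\<And>n. x n \<in> E" "\<And>n. s - inverse (real (Suc n)) < \<rho> (x n)"
    by metis
  have "MCauchy x"
    unfolding MCauchy_def
  proof (intro conjI allI impI)
    fix \<epsilon> :: real
    assume "0 < \<epsilon>"
    then obtain N where N: "inverse (real (Suc N)) < \<epsilon>"
      using reals_Archimedean by blast
    have close: "s - \<epsilon> < \<rho> (x n)" if "N \<le> n" for n
    proof -
      have "inverse (real (Suc n)) \<le> inverse (real (Suc N))" using that by simp
      with N x(2)[of n] show ?thesis by linarith
    qed
    have "rank_dist \<rho> (x m) (x n) < \<epsilon>" if "N \<le> m" "N \<le> n" for m n
      using close[OF that(1)] close[OF that(2)] le_s[OF x(1)[of m]] le_s[OF x(1)[of n]]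
      by (simp add: rank_dist_def rank_diff_nest[OF nest x(1) x(1)])
    then show "\<exists>N. \<forall>n n'. N \<le> n \<longrightarrow> N \<le> n' \<longrightarrow> rank_dist \<rho> (x n) (x n') < \<epsilon>" by blast
  qed simp
  then obtain l where "limitin mtopology x l sequentially"
    using complete unfolding complete_rank_function_def mcomplete_def by blast
  then have lim: "\<exists>N. \<forall>n\<ge>N. \<rho> (x n - l) < \<epsilon>" if "0 < \<epsilon>" for \<epsilon>
    using that unfolding limit_metric_sequentially rank_dist_def by blast
  have adh: "adherent l E"
    unfolding adherent_def using lim x(1) rank_minus by (metis minus_diff_eq order_refl)
  have le_l: "idem_le e l" if e: "e \<in> E" for e
  proof -
    have ee: "e * e = e" using e nest by (auto simp: nests_def idempotents_def)
    \<comment> \<open>If \<open>e\<close> lies below \<open>x n\<close>, both products equal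
      \<open>e\<close>. Otherwise both equal \<open>x n\<close>, and the error is
      \<open>\<rho> e - \<rho> (x n)\<close>, which is less than \<open>\<epsilon>\<close> since
      \<open>\<rho> e \<le> s\<close>.\<close>
    have small: "\<exists>n. \<rho> (x n - l) < \<epsilon> \<and> \<rho> (e * x n - e) < \<epsilon> \<and> \<rho> (x n * e - e) < \<epsilon>"
      if "0 < \<epsilon>" for \<epsilon>
    proof -
      obtain N where N: "\<And>n. n \<ge> N \<Longrightarrow> \<rho> (x n - l) < \<epsilon>" using lim \<open>0 < \<epsilon>\<close> by blast
      obtain K where K: "inverse (real (Suc K)) < \<epsilon>"
        using reals_Archimedean \<open>0 < \<epsilon>\<close> by blast
      define n where "n = max N K"
      have "inverse (real (Suc n)) \<le> inverse (real (Suc K))" by (simp add: n_def)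
      then have n: "s - \<epsilon> < \<rho> (x n)" using K x(2)[of n] by linarith
      consider "idem_le e (x n)" | "idem_le (x n) e"
        using nest e x(1) unfolding nests_def chain_def by blast
      then have "\<rho> (e * x n - e) < \<epsilon> \<and> \<rho> (x n * e - e) < \<epsilon>"
      proof cases
        case 1
        then show ?thesis using \<open>0 < \<epsilon>\<close> rank_function_zero[OF rank] by (simp add: idem_le_def)
      next
        case 2
        have "e \<in> idempotents" "x n \<in> idempotents" using nest e x(1) by (auto simp: nests_def)
        then have "\<rho> (e - x n) < \<epsilon>"
          using rank_diff_idem_le[OF _ _ 2] n le_s[OF e] by simp
        with 2 show ?thesis using rank_minus[of "e - x n"] by (simp add: idem_le_def)
      qed
      with N[of n] show ?thesis by (auto simp: n_def)
    qed
    have "e * l - e = 0"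
    proof (rule rank_eq_0)
      fix \<epsilon> :: real
      assume "0 < \<epsilon>"
      then obtain n where n: "\<rho> (x n - l) < \<epsilon> / 2" "\<rho> (e * x n - e) < \<epsilon> / 2"
        using small[of "\<epsilon> / 2"] by auto
      have "e * l - e = (e * x n - e) - e * (x n - l)" by (simp add: algebra_simps)
      also have "\<rho> \<dots> \<le> \<rho> (e * x n - e) + \<rho> (e * (x n - l))" by (rule rank_diff_le)
      finally show "\<rho> (e * l - e) \<le> \<epsilon>" using n rank_mult_le(2)[of e "x n - l"] by linarith
    qed
    moreover have "l * e - e = 0"
    proof (rule rank_eq_0)
      fix \<epsilon> :: real
      assume "0 < \<epsilon>"
      then obtain n where n: "\<rho> (x n - l) < \<epsilon> / 2" "\<rho> (x n * e - e) < \<epsilon> / 2"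
        using small[of "\<epsilon> / 2"] by auto
      have "l * e - e = (x n * e - e) - (x n - l) * e" by (simp add: algebra_simps)
      also have "\<rho> \<dots> \<le> \<rho> (x n * e - e) + \<rho> ((x n - l) * e)" by (rule rank_diff_le)
      finally show "\<rho> (l * e - e) \<le> \<epsilon>" using n rank_mult_le(1)[of "x n - l" e] by linarith
    qed
    ultimately show ?thesis by (simp add: idem_le_def)
  qed
  \<comment> \<open>The equation \<open>l * x = x\<close> holds for all \<open>x\<close> in
    \<open>E\<close> and passes to the limit \<open>x = l\<close>.\<close>
  have "l * l = l"
    using adherent_equation[OF adh, of l 1 1 1] le_l by (simp add: idem_le_def)
  then have "l \<in> idempotents" by (simp add: idempotents_def)
  with adh le_l show thesis using that by blast
qed

lemma nest_cut:
  fixes L U :: "'a set"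
  assumes L: "L \<in> nests" and U: "U \<in> nests" and g: "g \<in> idempotents"
    and LU: "\<And>x y. x \<in> L \<Longrightarrow> y \<in> U \<Longrightarrow> idem_le x y"
    and Lg: "\<And>x. x \<in> L \<Longrightarrow> g * x = x" and Ug: "\<And>y. y \<in> U \<Longrightarrow> y * g = g"
  obtains h where "h \<in> idempotents" "principal_right_ideal h = principal_right_ideal g"
    "\<And>x. x \<in> L \<Longrightarrow> idem_le x h" "\<And>y. y \<in> U \<Longrightarrow> idem_le h y"
proof -
  \<comment> \<open>Adjoining the least idempotent 0 meets the nonemptiness condition of
    \<open>nest_supremum\<close>, so \<open>L\<close> and \<open>U\<close> may be empty.\<close>
  have insert_0: "insert 0 E \<in> nests" if "E \<in> nests" for E :: "'a set"
    using that by (auto simp: nests_def chain_def idem_le_def idempotents_def)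
  obtain l where l: "l \<in> idempotents" "adherent l (insert 0 L)"
    "\<And>x. x \<in> insert 0 L \<Longrightarrow> idem_le x l"
    using nest_supremum[OF insert_0[OF L] insert_not_empty] by blast
  \<comment> \<open>\<open>1 - v\<close> serves as the infimum of \<open>U\<close>; it is 1 when
    \<open>U\<close> is empty.\<close>
  obtain v where v: "v \<in> idempotents" "adherent v (insert 0 ((\<lambda>y. 1 - y) ` U))"
    "\<And>z. z \<in> insert 0 ((\<lambda>y. 1 - y) ` U) \<Longrightarrow> idem_le z v"
    using nest_supremum[OF insert_0[OF nests_compl[OF U]] insert_not_empty] by blast
  \<comment> \<open>The limit is taken in two stages: first over \<open>L\<close> with
    \<open>y\<close> fixed, then over the complements of \<open>U\<close> with \<open>l\<close>
    fixed.\<close>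
  have Ul: "l * y = l" "y * l = l" if y: "y \<in> U" for y
  proof -
    have "x * y = x" "y * x = x" if "x \<in> insert 0 L" for x
      using LU[OF _ y] that by (auto simp: idem_le_def)
    then show "l * y = l" "y * l = l"
      using adherent_equation[OF l(2), of 1 y 1 1] adherent_equation[OF l(2), of y 1 1 1]
      by simp_all
  qed
  have "l * z = 0" "z * l = 0" "z * g = 0" if "z \<in> insert 0 ((\<lambda>y. 1 - y) ` U)" for z
    using that Ul Ug by (auto simp: left_diff_distrib right_diff_distrib)
  \<comment> \<open>Orthogonality of \<open>l\<close> and \<open>v\<close> means that
    \<open>l\<close> lies below \<open>1 - v\<close>, and \<open>v * g = 0\<close> means that
    \<open>1 - v\<close> fixes \<open>g\<close> from the left.\<close>
  then have "l * v = 0" "v * l = 0" "v * g = 0"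
    using adherent_equation[OF v(2), of l 1 0 0] adherent_equation[OF v(2), of 1 l 0 0]
      adherent_equation[OF v(2), of 1 g 0 0]
    by simp_all
  then have "idem_le l (1 - v)" "(1 - v) * g = g"
    by (simp_all add: idem_le_def left_diff_distrib right_diff_distrib)
  moreover have "g * l = l"
  proof -
    have "g * x = x" if "x \<in> insert 0 L" for x using that Lg by auto
    then show ?thesis using adherent_equation[OF l(2), of g 1 1 1] by simp
  qed
  ultimately obtain h where h: "h \<in> idempotents" "idem_le l h" "idem_le h (1 - v)"
    "principal_right_ideal h = principal_right_ideal g"
    using idempotent_interpolation[OF l(1) idempotents_compl[OF v(1)] g] by blast
  show thesis
  proof (rule that[OF h(1,4)])
    show "idem_le x h" if "x \<in> L" for x
      using idem_le_trans[OF l(3) h(2)] that by blast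
    show "idem_le h y" if "y \<in> U" for y
      using idem_le_trans[OF h(3)] idem_le_compl[OF v(3), of "1 - y"] that by simp
  qed
qed

section \<open>Lifting a flag to a nest by maximality\<close>

lemma flag_lift:
  fixes F :: "'a set set"
  assumes F: "F \<in> flags"
  obtains E where "E \<in> nests" "principal_right_ideal ` E = F"
proof -
  let ?A = "{E \<in> nests. principal_right_ideal ` E \<subseteq> F}"
  have "\<exists>M\<in>?A. \<forall>E\<in>?A. M \<subseteq> E \<longrightarrow> E = M"
  proof (rule subset_Zorn_nonempty)
    show "?A \<noteq> {}" by (auto simp: nests_def chain_def intro!: exI[of _ "{}"])
    fix C
    assume C: "C \<noteq> {}" "subset.chain ?A C"
    have "idem_le e f \<or> idem_le f e" if "X \<in> C" "Y \<in> C" "e \<in> X" "f \<in> Y" for X Y e f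
    proof -
      obtain Z where "Z \<in> C" "e \<in> Z" "f \<in> Z"
        using C(2) \<open>X \<in> C\<close> \<open>Y \<in> C\<close> \<open>e \<in> X\<close> \<open>f \<in> Y\<close> unfolding subset_chain_def by blast
      then show ?thesis using C(2) unfolding subset_chain_def nests_def chain_def by blast
    qed
    then have "Complete_Partial_Order.chain idem_le (\<Union>C)"
      unfolding chain_def by blast
    then show "\<Union>C \<in> ?A"
      using C(2) unfolding subset_chain_def nests_def by blast
  qed
  then obtain M where M: "M \<in> nests" "principal_right_ideal ` M \<subseteq> F"
    and max: "\<And>E. E \<in> nests \<Longrightarrow> principal_right_ideal ` E \<subseteq> F \<Longrightarrow> M \<subseteq> E \<Longrightarrow> E = M"
    by auto
  have Mi: "e \<in> idempotents" if "e \<in> M" for e using M(1) that by (auto simp: nests_def)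
  have "I \<in> principal_right_ideal ` M" if I: "I \<in> F" for I
  proof -
    obtain g where g: "g \<in> idempotents" "principal_right_ideal g = I"
      using idempotent_generator[OF reg, of I] F I unfolding flags_def by blast
    define L where "L = {e \<in> M. principal_right_ideal e \<subseteq> I}"
    define U where "U = {e \<in> M. I \<subseteq> principal_right_ideal e}"
    \<comment> \<open>Both \<open>I\<close> and the ideal of \<open>e\<close> belong to the chain
      \<open>F\<close>, so they are comparable.\<close>
    have M_split: "e \<in> L \<or> e \<in> U" if "e \<in> M" for e
      using F I M(2) that unfolding L_def U_def flags_def chain_def by blast
    have nests: "L \<in> nests" "U \<in> nests"
      using nests_subset[OF M(1)] by (auto simp: L_def U_def)
    \<comment> \<open>Inclusion of ideals yields only \<open>y * x = x\<close>. Comparability inside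
      \<open>M\<close> supplies the rest, since \<open>idem_le y x\<close> would then force
      \<open>x = y\<close>.\<close>
    have LU: "idem_le x y" if "x \<in> L" "y \<in> U" for x y
    proof -
      have xy: "x \<in> M" "y \<in> M" and "principal_right_ideal x \<subseteq> principal_right_ideal y"
        using that by (auto simp: L_def U_def)
      then have "y * x = x" using principal_right_ideal_subset_iff[OF Mi] by blast
      moreover have "idem_le x y \<or> idem_le y x"
        using M(1) xy unfolding nests_def chain_def by blast
      ultimately show ?thesis by (auto simp: idem_le_def)
    qed
    have "g * x = x" if "x \<in> L" for x
      using that g principal_right_ideal_subset_iff[OF g(1)] by (simp add: L_def)
    moreover have "y * g = g" if "y \<in> U" for y
      using that g principal_right_ideal_subset_iff[OF Mi] by (auto simp: U_def)
    ultimately obtain h where h: "h \<in> idempotents" "principal_right_ideal h = I"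
      "\<And>x. x \<in> L \<Longrightarrow> idem_le x h" "\<And>y. y \<in> U \<Longrightarrow> idem_le h y"
      using nest_cut[OF nests g(1) LU] g(2) by metis
    \<comment> \<open>Comparability of \<open>h\<close> with all of \<open>M\<close> makes
      \<open>insert h M\<close> a competitor in the Zorn argument, so \<open>h\<close> already lies
      in \<open>M\<close>.\<close>
    have "\<forall>e\<in>M. idem_le e h \<or> idem_le h e" using M_split h(3,4) by blast
    then have "insert h M \<in> nests"
      using M(1) h(1) idem_le_refl[OF h(1)] unfolding nests_def chain_def by auto
    then have "insert h M = M" using max[of "insert h M"] M(2) I h(2) by auto
    then show ?thesis using h(2) by blast
  qed
  with M show thesis using that by blast
qed

end

theorem proposition7p17:
  assumes "complete_rank_ring TYPE('a::ring_1)"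
  shows "(\<lambda>E::'a set. principal_right_ideal ` E) \<in> nests \<rightarrow> flags \<and>
    (\<lambda>E::'a set. principal_right_ideal ` E) ` nests = flags"
proof -
  obtain \<rho> :: "'a \<Rightarrow> real" where "complete_rank \<rho>"
    using assms unfolding complete_rank_ring_def complete_rank_def by blast
  then interpret complete_rank \<rho> .
  show ?thesis
  proof (intro conjI subset_antisym subsetI)
    fix F :: "'a set set"
    assume "F \<in> flags"
    then show "F \<in> (\<lambda>E. principal_right_ideal ` E) ` nests"
      by (metis flag_lift image_eqI)
  qed (auto intro: image_nest_in_flags)
qed

end
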